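(* For every integer $k \geq 3$, every finite simple graph $G$ is $1^k$-representable.
   Context: All graphs are simple and finite. $\mathbb{P}=\{1,2,\ldots\}$, $[n]=\{1,\ldots,n\}$, and $X^*$ denotes the set of all finite words over $X$. For a word $w$, $A(w)$ is the set of letters occurring in $w$; for $B\subseteq A(w)$, $w_B$ is the word obtained from $w$ by deleting all letters not in $B$. For a word $v\in\mathbb{P}^*$, $\mathrm{red}(v)$ is obtained from $v$ by replacing each occurrence of the $i$-th smallest letter occurring in $v$ by $i$. For a word $u$ of length $j$ with $\mathrm{red}(u)=u$, a word $w=w_1\cdots w_m$ has a $u$-match if $\mathrm{red}(w_iw_{i+1}\cdots w_{i+j-1})=u$ for some $i$. The word $1^k$ is $11\cdots1$ ($k$ ones); thus a word has a $1^k$-match if and only if it contains $k$ consecutive equal letters. A labeled graph $G=([n],E)$ is $u$-representable if there is a word $w\in[n]^*$ with $A(w)=[n]$ such that for all distinct $x,y\in[n]$: $xy\in E$ if and only if $w_{\{x,y\}}$ has no $u$-match. An unlabeled graph is $u$-representable if some labeling of its vertices by $[n]$ (where $n$ is the number of vertices) gives a $u$-representable labeled graph. *)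

theory Defs imports Main begin

definition red :: "nat list \<Rightarrow> nat list" where
  "red v = map (\<lambda>x. card {y \<in> set v. y \<le> x}) v"

definition restrict_word :: "'a list \<Rightarrow> 'a set \<Rightarrow> 'a list" where
  "restrict_word w B = filter (\<lambda>x. x \<in> B) w"

text \<open>Only meaningful for reduced patterns, i.e. those with \<open>red u = u\<close>; the constant
  patterns \<open>replicate k 1\<close> are reduced by the lemma below.\<close>

definition has_match :: "nat list \<Rightarrow> nat list \<Rightarrow> bool" where
  "has_match u w \<longleftrightarrow>
     (\<exists>i. i + length u \<le> length w \<and> red (take (length u) (drop i w)) = u)"

lemma red_replicate_1: "red (replicate k 1) = replicate k 1"
proof (cases "k = 0")
  case False
  then have "{y \<in> set (replicate k (1::nat)). y \<le> 1} = {1}" by auto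
  then show ?thesis by (simp add: red_def)
qed (simp add: red_def)

definition simple_graph :: "'a set \<Rightarrow> 'a set set \<Rightarrow> bool" where
  "simple_graph V E \<longleftrightarrow> finite V \<and> (\<forall>e\<in>E. e \<subseteq> V \<and> card e = 2)"

text \<open>Representability of the labeled graph with vertex set \<open>{1..n}\<close> and edge set \<open>E\<close>.\<close>

definition labeled_representable :: "nat list \<Rightarrow> nat \<Rightarrow> nat set set \<Rightarrow> bool" where
  "labeled_representable u n E \<longleftrightarrow>
     (\<exists>w. set w = {1..n} \<and>
        (\<forall>x\<in>{1..n}. \<forall>y\<in>{1..n}. x \<noteq> y \<longrightarrow>
           ({x, y} \<in> E \<longleftrightarrow> \<not> has_match u (restrict_word w {x, y}))))"

text \<open>Representability of an unlabeled graph: \<open>f\<close> is the labeling, which is free to be chosen.\<close>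

definition representable :: "nat list \<Rightarrow> 'a set \<Rightarrow> 'a set set \<Rightarrow> bool" where
  "representable u V E \<longleftrightarrow>
     (\<exists>f. bij_betw f V {1..card V} \<and> labeled_representable u (card V) ((`) f ` E))"

end

theory Submission imports Defs begin

text \<open>
  A word represents a graph when, for every pair of vertices, the projection to that pair has a run
  of \<open>k\<close> equal letters exactly if the pair is not an edge. Hence it suffices to find, for each
  non-edge \<open>xy\<close>, a word that creates such a run for \<open>xy\<close> and for no other pair, and then to
  concatenate these words without creating runs across the joints.

  Let \<open>R\<close> list the vertices other than \<open>x\<close> and \<open>y\<close>. The word \<open>y (x R)\<^sup>k\<^sup>-\<^sup>1 x y\<close> does the
  former: it projects to \<open>y x\<^sup>k y\<close> on \<open>{x, y}\<close>, but if \<open>z\<close> precedes \<open>t\<close> in \<open>R\<close>, then it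
  projects on \<open>{y, z}\<close>, \<open>{x, z}\<close> and \<open>{z, t}\<close> to \<open>y z\<^sup>k\<^sup>-\<^sup>1 y\<close>, one letter short of a run of
  length \<open>k\<close>, and to the alternating words \<open>(x z)\<^sup>k\<^sup>-\<^sup>1 x\<close> and \<open>(z t)\<^sup>k\<^sup>-\<^sup>1\<close> (lemma
  \<open>joinable_edge_breaker\<close>). The last three all begin and end with a run of length one. Therefore the runs across a joint have length at most two, which is harmless as
  \<open>k \<ge> 3\<close> (lemma \<open>joinable_append\<close>). Starting from a permutation of the vertices, which
  represents the complete graph, one thus removes the unwanted edges one at a time.
\<close>

section \<open>Runs of equal letters\<close>

definition has_run :: "nat \<Rightarrow> 'a list \<Rightarrow> bool" where
  "has_run k w \<longleftrightarrow> (\<exists>i a. i + k \<le> length w \<and> (\<forall>j<k. w ! (i + j) = a))"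

lemma red_eq_ones_iff:
  "red v = replicate (length v) 1 \<longleftrightarrow> (\<exists>a. v = replicate (length v) a)"
proof
  assume "red v = replicate (length v) 1"
  then have one: "card {y \<in> set v. y \<le> x} = 1" if "x \<in> set v" for x
    using that unfolding red_def map_replicate_const[symmetric] by (simp add: map_eq_conv)
  have le: "x = y" if "x \<in> set v" "y \<in> set v" "x \<le> y" for x y
  proof (rule ccontr)
    assume "x \<noteq> y"
    moreover have "card {x, y} \<le> card {z \<in> set v. z \<le> y}"
      using that by (intro card_mono) auto
    ultimately show False using one[OF that(2)] by simp
  qed
  have "\<forall>x\<in>set v. x = hd v"
  proof
    fix x assume "x \<in> set v"
    moreover from this have "hd v \<in> set v" by (cases v) simp_all
    ultimately show "x = hd v" using le[of x "hd v"] le[of "hd v" x] by linarith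
  qed
  then show "\<exists>a. v = replicate (length v) a"
    by (intro exI replicate_eqI) auto
next
  assume "\<exists>a. v = replicate (length v) a"
  then obtain a where a: "v = replicate (length v) a" ..
  then have "x = a" if "x \<in> set v" for x using that by (metis in_set_replicate)
  then have "{y \<in> set v. y \<le> x} = {x}" if "x \<in> set v" for x using that by auto
  then show "red v = replicate (length v) 1"
    unfolding red_def by (simp add: map_replicate_const[symmetric])
qed

lemma has_match_ones_iff: "has_match (replicate k 1) w \<longleftrightarrow> has_run k w"
proof -
  have "red (take k (drop i w)) = replicate k 1 \<longleftrightarrow> (\<exists>a. \<forall>j<k. w ! (i + j) = a)"
    if "i + k \<le> length w" for i
    using red_eq_ones_iff[of "take k (drop i w)"] that
    by (simp add: list_eq_iff_nth_eq)
  then show ?thesis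
    unfolding has_match_def has_run_def by auto
qed

lemma has_run_replicate: "has_run k (replicate k a)"
  unfolding has_run_def by (intro exI[of _ 0] exI[of _ a]) simp

lemma has_run_in_append:
  assumes "has_run k v"
  shows "has_run k (u @ v @ t)"
proof -
  obtain i a where "i + k \<le> length v" "\<forall>j<k. v ! (i + j) = a"
    using assms unfolding has_run_def by blast
  then show ?thesis
    unfolding has_run_def
    by (intro exI[of _ "length u + i"] exI[of _ a]) (simp add: nth_append)
qed

section \<open>Concatenation without new runs\<close>

text \<open>
  The condition on the two letters at either end is what makes the property stable under
  concatenation.
\<close>

definition joinable :: "nat \<Rightarrow> 'a list \<Rightarrow> bool" where
  "joinable k w \<longleftrightarrow> \<not> has_run k w \<and> 2 \<le> length w \<and>
     w ! 0 \<noteq> w ! 1 \<and> w ! (length w - 2) \<noteq> w ! (length w - 1)"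

text \<open>
  A run meeting both words can only consist of the last letter of \<open>u\<close> and the first letter of
  \<open>v\<close>; this is where \<open>k \<ge> 3\<close> is used.
\<close>

lemma joinable_append:
  assumes k: "k \<ge> 3" and u: "joinable k u" and v: "joinable k v"
  shows "joinable k (u @ v)"
proof -
  have lu: "2 \<le> length u" and lv: "2 \<le> length v"
    using u v unfolding joinable_def by auto
  have "\<not> has_run k (u @ v)"
  proof
    assume "has_run k (u @ v)"
    then obtain i a where i: "i + k \<le> length u + length v"
      and run: "\<And>j. j < k \<Longrightarrow> (u @ v) ! (i + j) = a"
      unfolding has_run_def by auto
    have at: "(u @ v) ! p = a" if "i \<le> p" "p < i + k" for p
      using run[of "p - i"] that by simp
    consider "i + k \<le> length u" | "length u \<le> i" | "i + 2 \<le> length u" "length u < i + k"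
      | "i + 1 = length u"
      by linarith
    then show False
    proof cases
      case 1
      then have "has_run k u"
        unfolding has_run_def using run
        by (intro exI[of _ i] exI[of _ a]) (simp add: nth_append)
      then show False using u unfolding joinable_def by blast
    next
      case 2
      have "v ! (i - length u + j) = a" if "j < k" for j
        using run[OF that] 2 by (simp add: nth_append)
      then have "has_run k v"
        unfolding has_run_def using i 2
        by (intro exI[of _ "i - length u"] exI[of _ a]) simp
      then show False using v unfolding joinable_def by blast
    next
      case 3
      have "length u - 2 < length u" "length u - 1 < length u" using lu by simp_all
      moreover have "(u @ v) ! (length u - 2) = a" "(u @ v) ! (length u - 1) = a"
        by (rule at; use 3 lu in linarith)+
      ultimately have "u ! (length u - 2) = a" "u ! (length u - 1) = a"
        by (simp_all only: nth_append if_True)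
      then show False using u unfolding joinable_def by simp
    next
      case 4
      then have "v ! 0 = a" "v ! 1 = a"
        using at[of "length u"] at[of "length u + 1"] k by (auto simp: nth_append)
      then show False using v unfolding joinable_def by simp
    qed
  qed
  moreover have "(u @ v) ! 0 \<noteq> (u @ v) ! 1"
  proof -
    have "0 < length u" "1 < length u" using lu by linarith+
    then show ?thesis using u unfolding joinable_def by (simp only: nth_append if_True) simp
  qed
  moreover have "(u @ v) ! (length (u @ v) - 2) \<noteq> (u @ v) ! (length (u @ v) - 1)"
  proof -
    have "length (u @ v) - 2 = length u + (length v - 2)"
      "length (u @ v) - 1 = length u + (length v - 1)"
      using lv by simp_all
    then show ?thesis
      using v unfolding joinable_def by (simp only: nth_append_length_plus) simp
  qed
  ultimately show ?thesis using lu unfolding joinable_def by simp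
qed

lemma joinable_append_concat:
  assumes "k \<ge> 3" "joinable k u" "\<forall>v\<in>set vs. joinable k v"
  shows "joinable k (u @ concat vs)"
  using assms(2,3)
proof (induction vs arbitrary: u)
  case (Cons v vs)
  then have "joinable k (u @ v)" "\<forall>v\<in>set vs. joinable k v"
    using joinable_append[OF assms(1) Cons.prems(1)] by simp_all
  then have "joinable k ((u @ v) @ concat vs)" by (rule Cons.IH)
  then show ?case by simp
qed simp

lemma joinable_if_distinct_adj:
  assumes "distinct_adj w" "2 \<le> length w" "2 \<le> k"
  shows "joinable k w"
proof -
  have adj: "w ! i \<noteq> w ! (i + 1)" if "i + 1 < length w" for i
    using assms(1) that by (simp add: distinct_adj_conv_nth)
  have "\<not> has_run k w"
  proof
    assume "has_run k w"
    then obtain i a where "i + k \<le> length w" and run: "\<And>j. j < k \<Longrightarrow> w ! (i + j) = a"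
      unfolding has_run_def by auto
    then show False using run[of 0] run[of 1] adj[of i] assms(3) by simp
  qed
  moreover have "w ! 0 \<noteq> w ! 1" using adj[of 0] assms(2) by simp
  moreover have "w ! (length w - 2) \<noteq> w ! (length w - 1)"
    using adj[of "length w - 2"] assms(2) by (simp add: numeral_2_eq_2 Suc_diff_Suc)
  ultimately show ?thesis using assms(2) unfolding joinable_def by simp
qed

lemma distinct_adj_alternating:
  assumes "a \<noteq> b"
  shows "distinct_adj (concat (replicate m [a, b]))"
    and "distinct_adj (concat (replicate m [a, b]) @ [a])"
proof (induction m)
  case (Suc m)
  {
    case 1
    show ?case using Suc(1) assms by (cases m) simp_all
  next
    case 2
    show ?case using Suc(2) assms by (cases m) simp_all
  }
qed simp_all

lemma concat_replicate_singleton: "concat (replicate m [a]) = replicate m a"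
  by (induction m) simp_all

lemma joinable_enclosed_run:
  assumes "a \<noteq> b" "2 \<le> k"
  shows "joinable k ([a] @ replicate (k - 1) b @ [a])"
proof -
  let ?w = "[a] @ replicate (k - 1) b @ [a]"
  have len: "length ?w = k + 1" using assms(2) by simp
  have inner: "?w ! p = b" if "1 \<le> p" "p < k" for p
  proof -
    have "p - 1 < k - 1" using that by simp
    then show ?thesis using that by (simp add: nth_append nth_Cons')
  qed
  have ends: "?w ! 0 = a" "?w ! k = a"
    using assms(2) by (simp_all add: nth_append nth_Cons')
  have "\<not> has_run k ?w"
  proof
    assume "has_run k ?w"
    then obtain i c where i: "i + k \<le> k + 1" and run: "\<And>j. j < k \<Longrightarrow> ?w ! (i + j) = c"
      unfolding has_run_def len by blast
    have at: "?w ! p = c" if "i \<le> p" "p < i + k" for p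
      using run[of "p - i"] that by simp
    (* A run of length k misses only one letter of the word, so it meets both an end and the
       inner block. *)
    show False
    proof (cases "i = 0")
      case True
      then show False using at[of 0] at[of 1] inner[of 1] ends(1) assms by simp
    next
      case False
      then have "i = 1" using i by simp
      then show False using at[of 1] at[of k] inner[of 1] ends(2) assms by simp
    qed
  qed
  moreover have "?w ! (length ?w - 2) = b" unfolding len using inner[of "k - 1"] assms(2) by simp
  moreover have "?w ! (length ?w - 1) = a" unfolding len using ends(2) by simp
  moreover have "?w ! 0 \<noteq> ?w ! 1" using ends(1) inner[of 1] assms by simp
  ultimately show ?thesis using assms unfolding joinable_def by simp
qed

section \<open>Words that break a single edge\<close>

lemma restrict_word_concat:
  "restrict_word (concat vs) B = concat (map (\<lambda>v. restrict_word v B) vs)"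
  unfolding restrict_word_def by (simp add: filter_concat)

lemma restrict_word_append:
  "restrict_word (u @ v) B = restrict_word u B @ restrict_word v B"
  unfolding restrict_word_def by simp

lemma restrict_word_single:
  assumes "distinct R" "set R \<inter> B = {z}"
  shows "restrict_word R B = [z]"
proof -
  have "set (restrict_word R B) = {z}" "distinct (restrict_word R B)"
    using assms unfolding restrict_word_def by auto
  moreover from this have "length (restrict_word R B) = 1"
    using distinct_card by fastforce
  ultimately show ?thesis by (auto simp: length_Suc_conv)
qed

lemma restrict_word_pair:
  assumes "distinct R" "set R \<inter> B = {a, b}" "a \<noteq> b"
  shows "restrict_word R B = [a, b] \<or> restrict_word R B = [b, a]"
proof -
  have s: "set (restrict_word R B) = {a, b}" and d: "distinct (restrict_word R B)"
    using assms unfolding restrict_word_def by auto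
  have "length (restrict_word R B) = 2"
    using distinct_card[OF d] s assms(3) by simp
  then obtain p q where "restrict_word R B = [p, q]"
    by (auto simp: numeral_2_eq_2 length_Suc_conv)
  then show ?thesis using s d by (auto simp: doubleton_eq_iff)
qed

definition edge_breaker :: "nat \<Rightarrow> 'a list \<Rightarrow> 'a \<Rightarrow> 'a \<Rightarrow> 'a list" where
  "edge_breaker k R x y = [y] @ concat (replicate (k - 1) (x # R)) @ [x, y]"

lemma set_edge_breaker_subset: "set (edge_breaker k R x y) \<subseteq> insert x (insert y (set R))"
  unfolding edge_breaker_def by auto

lemma restrict_edge_breaker:
  "restrict_word (edge_breaker k R x y) B =
     restrict_word [y] B @ concat (replicate (k - 1) (restrict_word [x] B @ restrict_word R B))
       @ restrict_word [x] B @ restrict_word [y] B"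
  unfolding edge_breaker_def restrict_word_def by (simp add: filter_concat)

lemma has_run_edge_breaker:
  assumes "x \<noteq> y" "x \<notin> set R" "y \<notin> set R" "k \<ge> 1"
  shows "has_run k (restrict_word (edge_breaker k R x y) {x, y})"
proof -
  have "restrict_word R {x, y} = []"
    using assms unfolding restrict_word_def by (auto simp: filter_empty_conv)
  then have "restrict_word (edge_breaker k R x y) {x, y} = [y] @ (replicate (k - 1) x @ [x]) @ [y]"
    unfolding restrict_edge_breaker
    by (simp add: restrict_word_def concat_replicate_singleton)
  moreover have "replicate (k - 1) x @ [x] = replicate k x"
    using assms(4) by (metis One_nat_def Suc_pred less_eq_Suc_le replicate_Suc replicate_append_same)
  ultimately show ?thesis
    by (simp only: has_run_in_append[OF has_run_replicate])
qed

text \<open>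
  Every letter other than \<open>x\<close> and \<open>y\<close> separates consecutive occurrences of \<open>x\<close>, and the letters
  \<open>y\<close> at both ends enclose only \<open>k - 1\<close> copies of it.
\<close>

lemma joinable_edge_breaker:
  assumes k: "k \<ge> 2" and R: "distinct R" "x \<notin> set R" "y \<notin> set R"
    and xy: "x \<noteq> y" and ab: "a \<noteq> b" "{a, b} \<noteq> {x, y}"
    and mem: "{a, b} \<subseteq> insert x (insert y (set R))"
  shows "joinable k (restrict_word (edge_breaker k R x y) {a, b})"
proof -
  have len: "2 \<le> length (concat (replicate (k - 1) [p, q]))" for p q :: 'a
    using k by (cases "k - 1") simp_all
  consider (y) z where "{a, b} = {y, z}" "z \<in> set R"
    | (x) z where "{a, b} = {x, z}" "z \<in> set R"
    | (rest) "a \<in> set R" "b \<in> set R"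
    using mem ab(2) ab(1) by blast
  then show ?thesis
  proof cases
    case y
    have zy: "z \<noteq> y" "z \<noteq> x" using y(2) R by auto
    have "restrict_word R {y, z} = [z]"
      using restrict_word_single[of R "{y, z}" z] y(2) R by auto
    then have "restrict_word (edge_breaker k R x y) {y, z} = [y] @ replicate (k - 1) z @ [y]"
      unfolding restrict_edge_breaker using zy xy
      by (simp add: restrict_word_def concat_replicate_singleton)
    then show ?thesis
      using joinable_enclosed_run[of y z k] zy k unfolding y(1) by simp
  next
    case x
    have zx: "z \<noteq> y" "z \<noteq> x" using x(2) R by auto
    have "restrict_word R {x, z} = [z]"
      using restrict_word_single[of R "{x, z}" z] x(2) R by auto
    then have "restrict_word (edge_breaker k R x y) {x, z} = concat (replicate (k - 1) [x, z]) @ [x]"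
      unfolding restrict_edge_breaker using zx xy by (simp add: restrict_word_def)
    then show ?thesis
      using joinable_if_distinct_adj[OF distinct_adj_alternating(2)[of x z "k - 1"]] zx len[of x z] k
      unfolding x(1) by simp
  next
    case rest
    then have nin: "x \<notin> {a, b}" "y \<notin> {a, b}" using R by auto
    have "set R \<inter> {a, b} = {a, b}" using rest by auto
    then obtain p q where "p \<noteq> q" "restrict_word R {a, b} = [p, q]"
      using restrict_word_pair[OF R(1)] ab(1) by metis
    moreover from this
    have "restrict_word (edge_breaker k R x y) {a, b} = concat (replicate (k - 1) [p, q])"
      unfolding restrict_edge_breaker using nin by (simp add: restrict_word_def)
    ultimately show ?thesis
      using joinable_if_distinct_adj[OF distinct_adj_alternating(1)[of p q "k - 1"]] len[of p q] k
      by simp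
  qed
qed

section \<open>Representing arbitrary graphs\<close>

lemma ex_word_avoiding_runs_exactly_on_edges:
  assumes k: "k \<ge> 3" and "finite V"
  shows "\<exists>w. set w = V \<and> (\<forall>a\<in>V. \<forall>b\<in>V. a \<noteq> b \<longrightarrow>
           ({a, b} \<in> E \<longleftrightarrow> \<not> has_run k (restrict_word w {a, b})))"
proof -
  obtain vs where vs: "set vs = V" "distinct vs"
    using finite_distinct_list[OF assms(2)] by blast
  define N where "N = {(x, y) \<in> V \<times> V. x \<noteq> y \<and> {x, y} \<notin> E}"
  have "finite N" unfolding N_def
    by (rule finite_subset[of _ "V \<times> V"]) (use assms(2) in auto)
  then obtain ns where ns: "set ns = N" using finite_list by blast
  define R where "R x y = filter (\<lambda>z. z \<notin> {x, y}) vs" for x y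
  have R: "distinct (R x y)" "x \<notin> set (R x y)" "y \<notin> set (R x y)" "set (R x y) = V - {x, y}"
    for x y using vs unfolding R_def by auto
  define piece where "piece = (\<lambda>(x, y). edge_breaker k (R x y) x y)"
  define w where "w = vs @ concat (map piece ns)"
  have "set (piece e) \<subseteq> V" if "e \<in> N" for e
    using that set_edge_breaker_subset[of k "R (fst e) (snd e)" "fst e" "snd e"] R(4)
    unfolding piece_def N_def by (auto split: prod.splits)
  then have "set w = V" unfolding w_def using vs ns by auto
  moreover have "{a, b} \<in> E \<longleftrightarrow> \<not> has_run k (restrict_word w {a, b})"
    if mem: "a \<in> V" "b \<in> V" and ab: "a \<noteq> b" for a b
  proof
    assume E: "{a, b} \<in> E"
    have "joinable k (restrict_word (piece e) {a, b})" if "e \<in> N" for e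
    proof -
      obtain x y where e: "e = (x, y)" by fastforce
      have xy: "x \<noteq> y" "{a, b} \<noteq> {x, y}" using that E unfolding e N_def by auto
      have "{a, b} \<subseteq> insert x (insert y (set (R x y)))"
        using mem R(4) by auto
      then show ?thesis
        using joinable_edge_breaker[of k "R x y" x y a b] R xy ab k
        unfolding e piece_def by auto
    qed
    moreover have "joinable k (restrict_word vs {a, b})"
    proof -
      have "set vs \<inter> {a, b} = {a, b}" using mem vs by auto
      from restrict_word_pair[OF vs(2) this ab] show ?thesis
        using ab k by (auto intro!: joinable_if_distinct_adj)
    qed
    ultimately have "joinable k (restrict_word w {a, b})"
      unfolding w_def restrict_word_append restrict_word_concat
      using ns by (intro joinable_append_concat[OF k]) auto
    then show "\<not> has_run k (restrict_word w {a, b})"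
      unfolding joinable_def by blast
  next
    assume norun: "\<not> has_run k (restrict_word w {a, b})"
    show "{a, b} \<in> E"
    proof (rule ccontr)
      assume "{a, b} \<notin> E"
      then have "(a, b) \<in> set ns" using mem ab ns unfolding N_def by simp
      then obtain us ts where "ns = us @ (a, b) # ts" by (meson split_list)
      then have "w = (vs @ concat (map piece us)) @ piece (a, b) @ concat (map piece ts)"
        unfolding w_def by simp
      moreover have "has_run k (restrict_word (piece (a, b)) {a, b})"
        using has_run_edge_breaker[of a b "R a b" k] ab R k unfolding piece_def by simp
      ultimately show False
        using norun has_run_in_append by (simp only: restrict_word_append) blast
    qed
  qed
  ultimately show ?thesis by blast
qed

lemma labeled_representable_ones:
  assumes "k \<ge> 3"
  shows "labeled_representable (replicate k 1) n F"
  unfolding labeled_representable_def has_match_ones_iff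
  by (rule ex_word_avoiding_runs_exactly_on_edges[OF assms]) simp

theorem theorem1:
  fixes k n :: nat and V :: "'a set" and E :: "'a set set" and F :: "nat set set"
  assumes "k \<ge> 3"
  shows "(simple_graph V E \<longrightarrow> representable (replicate k 1) V E) \<and>
         (simple_graph {1..n} F \<longrightarrow> labeled_representable (replicate k 1) n F)"
proof (intro conjI impI)
  assume "simple_graph V E"
  then have "finite V" unfolding simple_graph_def by blast
  then have "\<exists>f. bij_betw f V {1..card V}"
    by (intro finite_same_card_bij) auto
  then show "representable (replicate k 1) V E"
    unfolding representable_def using labeled_representable_ones[OF assms] by blast
next
  show "labeled_representable (replicate k 1) n F"
    using labeled_representable_ones[OF assms] .
qed

end
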